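(* Let $\Lambda=\{1,\dots,N\}$, let $X_i\subseteq\mathbb{R}^{n_i}$, $K_i:X\rightrightarrows\mathbb{R}^{n_i}$ and $P_i:\mathbb{R}^n\rightrightarrows\mathbb{R}^{n_i}$ ($i\in\Lambda$), where $n=\sum_{i\in\Lambda}n_i$ and $X=\prod_{i\in\Lambda}X_i$. Assume that for every $i\in\Lambda$: (a) $X_i$ is a non-empty closed convex subset of $\mathbb{R}^{n_i}$; (b) $K_i$ is a closed, lower semi-continuous map such that $K_i(x)$ is non-empty and convex for every $x\in X$; (c) $P_i$ has open graph, i.e. $\{(x,y_i)\in\mathbb{R}^n\times\mathbb{R}^{n_i}\mid y_i\in P_i(x)\}$ is open in $\mathbb{R}^n\times\mathbb{R}^{n_i}$; (d) $x_i\notin co(P_i(x))$ for every $x\in\prod_{j\in\Lambda}co(\overline{K_j(X)})$. If $K_i(X)$ is relatively compact for every $i\in\Lambda$, then the generalized Nash game $\Gamma=(X_i,K_i,P_i)_{i\in\Lambda}$ admits a projected solution.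
   Context: $n_i\ge 1$ are integers; spaces carry the Euclidean norm. $A\rightrightarrows B$ denotes a multi-valued map (each point of $A$ is sent to a possibly empty subset of $B$). A multi-valued map is closed if its graph is closed in the product of its domain and target space. $co$ denotes convex hull, an overline denotes closure, and $K_i(X)=\bigcup_{x\in X}K_i(x)$. A vector $x\in\mathbb{R}^n$ is written $x=(x_i)_{i\in\Lambda}$ with $x_i\in\mathbb{R}^{n_i}$. Projected solution of $\Gamma=(X_i,K_i,P_i)_{i\in\Lambda}$: a vector $\tilde x\in X$ for which there exists $\tilde y=(\tilde y_i)_{i\in\Lambda}\in\mathbb{R}^n$ such that (i) $\|\tilde y-\tilde x\|=\inf_{w\in X}\|\tilde y-w\|$ and (ii) for every $i\in\Lambda$, $\tilde y_i\in K_i(\tilde x)$ and $P_i(\tilde y)\cap K_i(\tilde x)=\emptyset$. *)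

theory Defs
  imports "HOL-Analysis.Analysis"
begin

text \<open>
  The index type \<open>'n\<close> enumerates the coordinates of \<open>\<real>\<^sup>n = real ^ 'n\<close>, and a map
  \<open>blk :: 'n \<Rightarrow> nat\<close> says to which player each coordinate belongs, so that \<open>\<real>\<^sup>n\<close> is the product
  of the spaces of the individual players. Since the dimensions of these spaces vary with the player,
  the space of player \<open>i\<close> is taken to be the coordinate subspace of vectors vanishing outside
  block \<open>i\<close>, with the topology and the Euclidean norm inherited from \<open>real ^ 'n\<close>. A vector is the
  tuple of its components \<open>component blk i x\<close>; see the three lemmas below.
\<close>

definition coord_space :: "('n \<Rightarrow> nat) \<Rightarrow> nat \<Rightarrow> (real ^ 'n) set" where
  "coord_space blk i = {v. \<forall>k. blk k \<noteq> i \<longrightarrow> v $ k = 0}"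

definition component :: "('n \<Rightarrow> nat) \<Rightarrow> nat \<Rightarrow> real ^ 'n \<Rightarrow> real ^ 'n" where
  "component blk i x = (\<chi> k. if blk k = i then x $ k else 0)"

definition block_prod :: "('n \<Rightarrow> nat) \<Rightarrow> nat set \<Rightarrow> (nat \<Rightarrow> (real ^ 'n) set) \<Rightarrow> (real ^ 'n) set" where
  "block_prod blk \<Lambda> S = {x. \<forall>i\<in>\<Lambda>. component blk i x \<in> S i}"

lemma dim_coord_space: "dim (coord_space blk i) = card {k::'n::finite. blk k = i}"
  using dim_substandard_cart[of "{k. blk k = i}", where ?'a = real]
  by (simp add: coord_space_def dim_vec_eq)

lemma sum_component:
  fixes x :: "real ^ 'n"
  assumes "finite \<Lambda>" and "\<forall>k. blk k \<in> \<Lambda>"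
  shows "(\<Sum>i\<in>\<Lambda>. component blk i x) = x"
  using assms by (simp add: vec_eq_iff component_def)

lemma bij_betw_components:
  fixes blk :: "'n::finite \<Rightarrow> nat"
  assumes "finite \<Lambda>" and "\<forall>k. blk k \<in> \<Lambda>"
  shows "bij_betw (\<lambda>x. \<lambda>i\<in>\<Lambda>. component blk i x) UNIV (\<Pi>\<^sub>E i\<in>\<Lambda>. coord_space blk i)"
proof (rule bij_betw_byWitness[where f' = "\<lambda>f. \<Sum>i\<in>\<Lambda>. f i"])
  show "\<forall>x\<in>UNIV. (\<Sum>i\<in>\<Lambda>. (\<lambda>i\<in>\<Lambda>. component blk i x) i) = x"
    using sum_component[OF assms] by simp
  have "component blk j (\<Sum>i\<in>\<Lambda>. f i) = f j"
    if f: "f \<in> (\<Pi>\<^sub>E i\<in>\<Lambda>. coord_space blk i)" and j: "j \<in> \<Lambda>" for f j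
  proof -
    have z: "f i $ k = 0" if "i \<in> \<Lambda>" "blk k \<noteq> i" for i k
      using f that by (auto simp: coord_space_def PiE_def Pi_def)
    have "(\<Sum>i\<in>\<Lambda>. f i $ k) = f j $ k" if "blk k = j" for k
      using assms j that z by (subst sum.remove[of _ j]) (auto intro!: sum.neutral)
    then show ?thesis using z[OF j] by (auto simp: vec_eq_iff component_def)
  qed
  then show "\<forall>f\<in>(\<Pi>\<^sub>E i\<in>\<Lambda>. coord_space blk i). (\<lambda>i\<in>\<Lambda>. component blk i (\<Sum>i\<in>\<Lambda>. f i)) = f"
    by (auto intro!: ext simp: PiE_def extensional_def)
qed (auto simp: coord_space_def component_def)

definition multimap_on :: "'a set \<Rightarrow> 'b set \<Rightarrow> ('a \<Rightarrow> 'b set) \<Rightarrow> bool" where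
  "multimap_on A B F \<longleftrightarrow> (\<forall>x\<in>A. F x \<subseteq> B)"

text \<open>\<open>Sigma A F\<close> is the graph of a multi-valued map \<open>F\<close> with domain \<open>A\<close>.\<close>

definition closed_multimap :: "'a::topological_space set \<Rightarrow> 'b::topological_space set \<Rightarrow> ('a \<Rightarrow> 'b set) \<Rightarrow> bool" where
  "closed_multimap A B F \<longleftrightarrow> closedin (top_of_set (A \<times> B)) (Sigma A F)"

definition open_graph :: "'a::topological_space set \<Rightarrow> 'b::topological_space set \<Rightarrow> ('a \<Rightarrow> 'b set) \<Rightarrow> bool" where
  "open_graph A B F \<longleftrightarrow> openin (top_of_set (A \<times> B)) (Sigma A F)"

definition lsc_multimap :: "'a::topological_space set \<Rightarrow> 'b::topological_space set \<Rightarrow> ('a \<Rightarrow> 'b set) \<Rightarrow> bool" where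
  "lsc_multimap A B F \<longleftrightarrow>
     (\<forall>V. openin (top_of_set B) V \<longrightarrow> openin (top_of_set A) {x \<in> A. F x \<inter> V \<noteq> {}})"

definition projected_solution ::
  "('n::finite \<Rightarrow> nat) \<Rightarrow> nat set \<Rightarrow> (nat \<Rightarrow> (real ^ 'n) set) \<Rightarrow> (nat \<Rightarrow> real ^ 'n \<Rightarrow> (real ^ 'n) set) \<Rightarrow>
   (nat \<Rightarrow> real ^ 'n \<Rightarrow> (real ^ 'n) set) \<Rightarrow> real ^ 'n \<Rightarrow> bool" where
  "projected_solution blk \<Lambda> X K P x \<longleftrightarrow>
     x \<in> block_prod blk \<Lambda> X \<and>
     (\<exists>y. norm (y - x) = (INF w\<in>block_prod blk \<Lambda> X. norm (y - w)) \<and>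
          (\<forall>i\<in>\<Lambda>. component blk i y \<in> K i x \<and> P i y \<inter> K i x = {}))"

end

theory Submission
  imports Defs
begin

text \<open>
  Composing the constraint maps with the metric projection \<open>p\<close> onto \<open>X\<close> removes the difficulty that
  the values of \<open>K\<close> may leave \<open>X\<close>. The maps \<open>y \<mapsto> K\<^sub>i (p y)\<close> live on the compact
  convex set \<open>C\<close>, the product of the hulls of the closures of \<open>K\<^sub>i(X)\<close>, and send \<open>C\<close> into its
  factors; as \<open>p\<close> is continuous, they inherit closed graphs and lower semicontinuity. If \<open>y\<close> is an
  equilibrium of the resulting generalized game on \<open>C\<close>, then \<open>p y\<close> is a projected solution, with
  \<open>y\<close> as witness: the nearest point of \<open>X\<close> to \<open>y\<close> is \<open>p y\<close> by construction.

  Such an equilibrium exists by the theorem of Shafer and Sonnenschein (\<open>Shafer_Sonnenschein\<close>).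
  Openness of the graph of \<open>P\<^sub>i\<close> gives a continuous nonnegative utility that is positive at \<open>(y, v)\<close>
  exactly when \<open>v \<in> P\<^sub>i y\<close>, in essence the distance from the complement of the graph.
  Its maximizers over the feasible set form a best reply map with closed graph (\<open>closed_graph_best_replies\<close>, which is where lower semicontinuity enters). The
  values of this map need not be convex, but some \<open>y\<close> lies in the convex hull of its own best replies
  (\<open>fixed_point_in_convex_hull\<close>, a form of Kakutani's theorem). Then each component of \<open>y\<close> is
  feasible, feasible sets being convex. Were a player able to improve, the maximal utility would be
  positive, all best replies would lie in \<open>P\<^sub>i y\<close>, and so \<open>y\<^sub>i\<close> would lie in the convex hull of
  \<open>P\<^sub>i y\<close>, against assumption (d).
\<close>

section \<open>A fixed point theorem for maps with closed graph\<close>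

lemma closed_set_as_zero_set:
  fixes Z :: "'a::metric_space set"
  assumes "closed Z"
  obtains g :: "'a \<Rightarrow> real"
  where "continuous_on UNIV g" "\<And>x. 0 \<le> g x" "\<And>x. g x = 0 \<longleftrightarrow> x \<in> Z"
proof (cases "Z = {}")
  \<comment> \<open>\<open>infdist x {}\<close> is 0 by convention, the wrong value here.\<close>
  case True
  then show ?thesis
    using that[of "\<lambda>x. 1"] by simp
next
  case False
  then show ?thesis
    using that[of "\<lambda>x. infdist x Z"] in_closed_iff_infdist_zero[OF assms False]
      continuous_on_infdist[OF continuous_on_id] infdist_nonneg
    by metis
qed

text \<open>
  A point fixed by \<open>x \<mapsto> closest_point C (x + A x)\<close>, which Brouwer's theorem provides, is one
  at which \<open>A x\<close> is an outward normal of \<open>C\<close>.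
\<close>

lemma variational_inequality:
  fixes A :: "'a::euclidean_space \<Rightarrow> 'a"
  assumes "compact C" "convex C" "C \<noteq> {}" "continuous_on C A"
  obtains x where "x \<in> C" "\<And>y. y \<in> C \<Longrightarrow> A x \<bullet> (y - x) \<le> 0"
proof -
  have cl: "closed C"
    using assms by (simp add: compact_imp_closed)
  have "continuous_on C (closest_point C \<circ> (\<lambda>x. x + A x))"
    using assms cl
    by (intro continuous_on_compose continuous_on_closest_point continuous_intros) auto
  moreover have "closest_point C \<circ> (\<lambda>x. x + A x) \<in> C \<rightarrow> C"
    using closest_point_in_set[OF cl \<open>C \<noteq> {}\<close>] by simp
  ultimately obtain x where x: "x \<in> C" "(closest_point C \<circ> (\<lambda>x. x + A x)) x = x"
    using brouwer[OF assms(1-3)] by metis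
  have "A x \<bullet> (y - x) \<le> 0" if "y \<in> C" for y
    using closest_point_dot[OF \<open>convex C\<close> cl that, of "x + A x"] x by simp
  then show ?thesis
    using that x(1) by blast
qed

lemma closed_value_of_closed_graph:
  assumes "closed (Sigma S F)" "x \<in> S"
  shows "closed (F x)"
proof -
  have "F x = Pair x -` Sigma S F"
    using assms(2) by auto
  then show ?thesis
    using assms(1) by (auto intro!: closed_vimage continuous_intros)
qed

text \<open>
  If no \<open>x\<close> lies in the hull of its values, each \<open>x\<close> is strictly separated from \<open>\<Phi> x\<close> by some
  functional \<open>a\<close>. The set \<open>Z a\<close> of points where \<open>a\<close> fails to separate is the projection of a
  compact set, hence closed, so finitely many functionals serve all of \<open>C\<close>. Weighting each of them
  by a continuous function that vanishes exactly on \<open>Z a\<close> glues them to a continuous field \<open>A\<close> such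
  that \<open>A x\<close> separates \<open>x\<close> from \<open>\<Phi> x\<close> everywhere, which contradicts the variational inequality.
\<close>

lemma fixed_point_in_convex_hull:
  fixes \<Phi> :: "'a::euclidean_space \<Rightarrow> 'a set"
  assumes C: "compact C" "convex C" "C \<noteq> {}"
    and \<Phi>: "\<And>x. x \<in> C \<Longrightarrow> \<Phi> x \<noteq> {}" "\<And>x. x \<in> C \<Longrightarrow> \<Phi> x \<subseteq> C"
    and closed_graph: "closed (Sigma C \<Phi>)"
  shows "\<exists>x\<in>C. x \<in> convex hull (\<Phi> x)"
proof (rule ccontr)
  assume none: "\<not> ?thesis"
  have graph: "compact (Sigma C \<Phi>)"
  proof -
    have "Sigma C \<Phi> = (C \<times> C) \<inter> Sigma C \<Phi>"
      using \<Phi>(2) by blast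
    then show ?thesis
      using compact_Int_closed[OF compact_Times[OF C(1) C(1)] closed_graph] by simp
  qed
  have compact_value: "compact (\<Phi> x)" if "x \<in> C" for x
    using compact_Int_closed[OF C(1) closed_value_of_closed_graph[OF closed_graph that]] \<Phi>(2)[OF that]
    by (simp add: inf.absorb2)
  define Z where "Z a = fst ` (Sigma C \<Phi> \<inter> {p. a \<bullet> snd p \<le> a \<bullet> fst p})" for a
  have closed_Z: "closed (Z a)" for a
  proof -
    have "closed {p :: 'a \<times> 'a. a \<bullet> snd p \<le> a \<bullet> fst p}"
      by (intro closed_Collect_le continuous_intros)
    then have "compact (Sigma C \<Phi> \<inter> {p. a \<bullet> snd p \<le> a \<bullet> fst p})"
      using graph by (simp add: compact_Int_closed)
    then show ?thesis
      unfolding Z_def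
      by (intro compact_imp_closed compact_continuous_image continuous_intros)
  qed
  have "C \<subseteq> (\<Union>a. - Z a)"
  proof
    fix x assume "x \<in> C"
    then have "x \<notin> convex hull (\<Phi> x)" "closed (convex hull (\<Phi> x))"
      using none compact_value by (auto intro: compact_imp_closed compact_convex_hull)
    then obtain a b where "a \<bullet> x < b" "\<forall>y\<in>convex hull (\<Phi> x). b < a \<bullet> y"
      using separating_hyperplane_closed_point[OF convex_convex_hull] by meson
    then have "a \<bullet> x < a \<bullet> y" if "y \<in> \<Phi> x" for y
      using that by (meson hull_inc less_trans)
    then have "x \<notin> Z a"
      by (fastforce simp: Z_def)
    then show "x \<in> (\<Union>a. - Z a)"
      by blast
  qed
  then obtain D where D: "finite D" "C \<subseteq> (\<Union>a\<in>D. - Z a)"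
    using compactE_image[OF C(1), of UNIV "\<lambda>a. - Z a"] closed_Z by (metis open_Compl UNIV_I)
  have "\<exists>g. continuous_on UNIV g \<and> (\<forall>x. 0 \<le> g x) \<and> (\<forall>x. g x = (0::real) \<longleftrightarrow> x \<in> Z a)" for a
    using closed_set_as_zero_set[OF closed_Z] by metis
  then obtain g where g: "\<And>a. continuous_on UNIV (g a)" "\<And>a x. (0::real) \<le> g a x"
    "\<And>a x. g a x = 0 \<longleftrightarrow> x \<in> Z a"
    by metis
  define A where "A x = (\<Sum>a\<in>D. g a x *\<^sub>R a)" for x
  have "continuous_on C A"
    unfolding A_def by (intro continuous_intros continuous_on_subset[OF g(1)]) auto
  then obtain x where x: "x \<in> C" "\<And>y. y \<in> C \<Longrightarrow> A x \<bullet> (y - x) \<le> 0"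
    using variational_inequality[OF C] by blast
  obtain y where y: "y \<in> \<Phi> x"
    using \<Phi>(1)[OF x(1)] by blast
  have gap: "a \<bullet> x < a \<bullet> y" if "x \<notin> Z a" for a
    using that x(1) y by (force simp: Z_def)
  obtain a where a: "a \<in> D" "x \<notin> Z a"
    using D(2) x(1) by blast
  have "0 < (\<Sum>a\<in>D. g a x * (a \<bullet> (y - x)))"
  proof (rule sum_pos2)
    show "finite D" by (rule D(1))
    show "0 \<le> g a x * (a \<bullet> (y - x))" for a
      using gap[of a] g(2)[of a x] g(3)[of a x]
      by (cases "x \<in> Z a") (auto simp: inner_diff_right)
    show "a \<in> D" by (rule a(1))
    have "0 < g a x"
      using a(2) g(2)[of a x] g(3)[of a x] by linarith
    then show "0 < g a x * (a \<bullet> (y - x))"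
      using gap[OF a(2)] by (simp add: inner_diff_right)
  qed
  also have "\<dots> = A x \<bullet> (y - x)"
    by (simp add: A_def inner_sum_left)
  finally show False
    using x y \<Phi>(2) by force
qed

section \<open>Closed graph of the best reply map\<close>

definition best_replies :: "('a \<Rightarrow> 'b set) \<Rightarrow> ('a \<times> 'b \<Rightarrow> real) \<Rightarrow> 'a \<Rightarrow> 'b set" where
  "best_replies T u x = {w \<in> T x. \<forall>v\<in>T x. u (x, v) \<le> u (x, w)}"

text \<open>
  One half of Berge's maximum theorem. A feasible \<open>w\<close> that is beaten by \<open>v\<close> at \<open>x\<close> stays beaten
  nearby: by lower semicontinuity the feasible sets at points near \<open>x\<close> still meet each neighbourhood
  of \<open>v\<close>, and a level \<open>t\<close> strictly between the two utilities separates them uniformly.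
\<close>

lemma closed_graph_best_replies:
  fixes T :: "'a::metric_space \<Rightarrow> 'b::metric_space set"
  assumes graph: "closed (Sigma S T)"
    and lsc: "lsc_multimap S B T" and range: "\<And>x. x \<in> S \<Longrightarrow> T x \<subseteq> B"
    and u: "continuous_on UNIV u"
  shows "closed (Sigma S (best_replies T u))"
proof -
  have neighbourhood: "\<exists>U. open U \<and> p \<in> U \<and> U \<subseteq> - Sigma S (best_replies T u)"
    if p: "p \<in> - Sigma S (best_replies T u)" for p
  proof (cases "p \<in> Sigma S T")
    case False
    then show ?thesis
      using graph by (intro exI[of _ "- Sigma S T"]) (auto simp: best_replies_def)
  next
    case True
    then obtain x w where xw: "p = (x, w)" "x \<in> S" "w \<in> T x"
      by blast
    then obtain v where v: "v \<in> T x" "u (x, w) < u (x, v)"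
      using p by (auto simp: best_replies_def not_le)
    obtain t where t: "u (x, w) < t" "t < u (x, v)"
      using dense[OF v(2)] by blast
    have "open {q. t < u q}" "open {q. u q < t}"
      using u by (auto intro!: open_Collect_less continuous_on_const)
    moreover have "(x, v) \<in> {q. t < u q}" "(x, w) \<in> {q. u q < t}"
      using t by auto
    ultimately obtain A V A' W where
      AV: "open A" "open V" "(x, v) \<in> A \<times> V" "A \<times> V \<subseteq> {q. t < u q}" and
      AW: "open A'" "open W" "(x, w) \<in> A' \<times> W" "A' \<times> W \<subseteq> {q. u q < t}"
      using open_prod_elim[of "{q. t < u q}" "(x, v)"] open_prod_elim[of "{q. u q < t}" "(x, w)"]
      by metis
    have "openin (top_of_set S) {z \<in> S. T z \<inter> (B \<inter> V) \<noteq> {}}"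
      using lsc AV(2) unfolding lsc_multimap_def by (simp add: openin_open_Int)
    then obtain R where R: "open R" "{z \<in> S. T z \<inter> (B \<inter> V) \<noteq> {}} = S \<inter> R"
      by (auto simp: openin_open)
    have "x \<in> R"
      using R(2) xw(2) v(1) AV(3) range by blast
    moreover have "False"
      if z: "z \<in> A \<inter> A' \<inter> R" "w' \<in> W" "z \<in> S" "w' \<in> best_replies T u z" for z w'
    proof -
      obtain v' where "v' \<in> T z" "v' \<in> V"
        using R(2) z by blast
      then show False
        using AV(4) AW(4) z by (force simp: best_replies_def)
    qed
    ultimately show ?thesis
      using xw AV AW R(1)
      by (intro exI[of _ "(A \<inter> A' \<inter> R) \<times> W"]) (auto intro!: open_Times)
  qed
  have "open (- Sigma S (best_replies T u))"
    by (subst open_subopen) (intro ballI neighbourhood)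
  then show ?thesis
    by (simp add: closed_def)
qed

section \<open>Products over the blocks\<close>

lemma linear_component: "linear (component blk i)"
  by (rule linearI) (auto simp: component_def vec_eq_iff)

lemma continuous_on_component:
  fixes blk :: "'n::finite \<Rightarrow> nat"
  assumes "continuous_on S f"
  shows "continuous_on S (\<lambda>x. component blk i (f x))"
  using bounded_linear.continuous_on[OF linear_component[THEN linear_linear[THEN iffD2]] assms] .

lemma component_sum_of_blocks:
  fixes blk :: "'n::finite \<Rightarrow> nat"
  assumes "finite \<Lambda>" "\<forall>k. blk k \<in> \<Lambda>" "\<And>i. i \<in> \<Lambda> \<Longrightarrow> f i \<in> coord_space blk i" "j \<in> \<Lambda>"
  shows "component blk j (\<Sum>i\<in>\<Lambda>. f i) = f j"
proof -
  have "component blk j (f i) = (if i = j then f j else 0)" if "i \<in> \<Lambda>" for i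
    using assms(3)[OF that] by (auto simp: coord_space_def component_def vec_eq_iff)
  then show ?thesis
    using assms(1,4) by (simp add: linear_sum[OF linear_component] cong: sum.cong)
qed

lemma block_prod_eq_INT: "block_prod blk \<Lambda> S = (\<Inter>i\<in>\<Lambda>. component blk i -` S i)"
  by (auto simp: block_prod_def)

lemma convex_block_prod:
  "(\<And>i. i \<in> \<Lambda> \<Longrightarrow> convex (S i)) \<Longrightarrow> convex (block_prod blk \<Lambda> S)"
  unfolding block_prod_eq_INT by (intro convex_INT convex_linear_vimage linear_component)

lemma closed_block_prod:
  fixes blk :: "'n::finite \<Rightarrow> nat"
  shows "(\<And>i. i \<in> \<Lambda> \<Longrightarrow> closed (S i)) \<Longrightarrow> closed (block_prod blk \<Lambda> S)"
  unfolding block_prod_eq_INT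
  by (intro closed_INT ballI closed_vimage continuous_on_component continuous_on_id)

lemma compact_block_prod:
  fixes blk :: "'n::finite \<Rightarrow> nat"
  assumes \<Lambda>: "finite \<Lambda>" "\<forall>k. blk k \<in> \<Lambda>"
    and S: "\<And>i. i \<in> \<Lambda> \<Longrightarrow> compact (S i)"
  shows "compact (block_prod blk \<Lambda> S)"
proof -
  have "\<forall>i\<in>\<Lambda>. \<exists>r. \<forall>x\<in>S i. norm x \<le> r"
    using S by (meson bounded_iff compact_imp_bounded)
  then obtain r where r: "\<And>i x. i \<in> \<Lambda> \<Longrightarrow> x \<in> S i \<Longrightarrow> norm x \<le> r i"
    by metis
  have "norm x \<le> (\<Sum>i\<in>\<Lambda>. r i)" if "x \<in> block_prod blk \<Lambda> S" for x
  proof -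
    have "norm (\<Sum>i\<in>\<Lambda>. component blk i x) \<le> (\<Sum>i\<in>\<Lambda>. r i)"
      using that r by (intro sum_norm_le) (auto simp: block_prod_def)
    then show ?thesis
      by (simp add: sum_component[OF \<Lambda>])
  qed
  then show ?thesis
    using S by (auto simp: compact_eq_bounded_closed bounded_iff intro!: closed_block_prod)
qed

lemma block_prod_nonempty:
  fixes blk :: "'n::finite \<Rightarrow> nat"
  assumes "finite \<Lambda>" "\<forall>k. blk k \<in> \<Lambda>"
    and "\<And>i. i \<in> \<Lambda> \<Longrightarrow> S i \<subseteq> coord_space blk i" "\<And>i. i \<in> \<Lambda> \<Longrightarrow> S i \<noteq> {}"
  shows "block_prod blk \<Lambda> S \<noteq> {}"
proof -
  obtain f where f: "\<And>i. i \<in> \<Lambda> \<Longrightarrow> f i \<in> S i"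
    using bchoice[of \<Lambda> "\<lambda>i x. x \<in> S i"] assms(4) by blast
  then have "component blk i (\<Sum>i\<in>\<Lambda>. f i) \<in> S i" if "i \<in> \<Lambda>" for i
    using component_sum_of_blocks[OF assms(1,2), of f i] assms(3) that by (metis subsetD)
  then have "(\<Sum>i\<in>\<Lambda>. f i) \<in> block_prod blk \<Lambda> S"
    by (simp add: block_prod_def)
  then show ?thesis
    by blast
qed

text \<open>
  A point in the hull of a product of best reply sets has its components in the hulls of the factors,
  so a fixed point in the product space can be examined player by player.
\<close>

lemma convex_hull_block_prod_subset:
  "component blk i ` (convex hull (block_prod blk \<Lambda> S)) \<subseteq> convex hull (S i)" if "i \<in> \<Lambda>"
  using that unfolding convex_hull_linear_image[OF linear_component]
  by (intro hull_mono) (auto simp: block_prod_def)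

lemma subspace_coord_space: "subspace (coord_space blk i)"
  by (auto simp: subspace_def coord_space_def)

section \<open>Equilibria of generalized games on a compact domain\<close>

text \<open>
  The graph is open only relative to \<open>UNIV \<times> B\<close>, so the utility is made to vanish
  exactly on the relative complement, and its sign carries information only for \<open>v \<in> B\<close>.
\<close>

lemma utility_of_open_graph:
  fixes P :: "'a::metric_space \<Rightarrow> 'b::metric_space set"
  assumes "open_graph UNIV B P" "closed B"
  obtains u :: "'a \<times> 'b \<Rightarrow> real" where "continuous_on UNIV u"
    "\<And>x v. v \<in> B \<Longrightarrow> 0 < u (x, v) \<longleftrightarrow> v \<in> P x"
proof -
  have "closedin (top_of_set (UNIV \<times> B)) ((UNIV \<times> B) - Sigma UNIV P)"
    using assms(1) by (auto simp: open_graph_def)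
  then have "closed ((UNIV \<times> B) - Sigma UNIV P)"
    using assms(2) closedin_closed_trans closed_Times closed_UNIV by blast
  then obtain u :: "'a \<times> 'b \<Rightarrow> real" where u: "continuous_on UNIV u" "\<And>p. 0 \<le> u p"
    "\<And>p. u p = 0 \<longleftrightarrow> p \<in> (UNIV \<times> B) - Sigma UNIV P"
    using closed_set_as_zero_set by blast
  have "0 < u (x, v) \<longleftrightarrow> v \<in> P x" if "v \<in> B" for x v
    using u(2)[of "(x, v)"] u(3)[of "(x, v)"] that by auto
  then show ?thesis
    using that u by blast
qed

text \<open>
  The fixed point theorem is applied to the product \<open>\<Phi>\<close> of the best reply maps. Taking the hull of
  best replies costs nothing: feasibility is kept because \<open>T i y\<close> is convex, and the irreflexivity
  assumption on preferences already speaks of the hull of \<open>P i y\<close>.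
\<close>

lemma Shafer_Sonnenschein:
  fixes blk :: "'n::finite \<Rightarrow> nat"
  assumes \<Lambda>: "finite \<Lambda>" "\<forall>k. blk k \<in> \<Lambda>"
    and D: "\<And>i. i \<in> \<Lambda> \<Longrightarrow> compact (D i)" "\<And>i. i \<in> \<Lambda> \<Longrightarrow> convex (D i)" "\<And>i. i \<in> \<Lambda> \<Longrightarrow> D i \<noteq> {}"
      "\<And>i. i \<in> \<Lambda> \<Longrightarrow> D i \<subseteq> coord_space blk i"
    and C_def: "C = block_prod blk \<Lambda> D"
    and T: "\<And>i y. i \<in> \<Lambda> \<Longrightarrow> y \<in> C \<Longrightarrow> T i y \<noteq> {}" "\<And>i y. i \<in> \<Lambda> \<Longrightarrow> y \<in> C \<Longrightarrow> convex (T i y)"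
      "\<And>i y. i \<in> \<Lambda> \<Longrightarrow> y \<in> C \<Longrightarrow> T i y \<subseteq> D i"
      "\<And>i. i \<in> \<Lambda> \<Longrightarrow> closed (Sigma C (T i))"
      "\<And>i. i \<in> \<Lambda> \<Longrightarrow> lsc_multimap C (coord_space blk i) (T i)"
    and P: "\<And>i. i \<in> \<Lambda> \<Longrightarrow> open_graph UNIV (coord_space blk i) (P i)"
      "\<And>i y. i \<in> \<Lambda> \<Longrightarrow> y \<in> C \<Longrightarrow> component blk i y \<notin> convex hull (P i y)"
  shows "\<exists>y\<in>C. \<forall>i\<in>\<Lambda>. component blk i y \<in> T i y \<and> P i y \<inter> T i y = {}"
proof -
  have "\<forall>i\<in>\<Lambda>. \<exists>u. continuous_on UNIV u \<and>
      (\<forall>x v. v \<in> coord_space blk i \<longrightarrow> ((0::real) < u (x, v) \<longleftrightarrow> v \<in> P i x))"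
    using utility_of_open_graph[OF P(1) closed_subspace[OF subspace_coord_space]] by metis
  then obtain u where u: "\<And>i. i \<in> \<Lambda> \<Longrightarrow> continuous_on UNIV (u i)"
    "\<And>i x v. i \<in> \<Lambda> \<Longrightarrow> v \<in> coord_space blk i \<Longrightarrow> (0::real) < u i (x, v) \<longleftrightarrow> v \<in> P i x"
    by metis
  define F where "F i = best_replies (T i) (u i)" for i
  define \<Phi> where "\<Phi> y = block_prod blk \<Lambda> (\<lambda>i. F i y)" for y
  have C: "compact C" "convex C" "C \<noteq> {}"
    unfolding C_def using D \<Lambda> block_prod_nonempty[of \<Lambda> blk D]
    by (auto intro!: compact_block_prod convex_block_prod)
  have F_sub: "F i y \<subseteq> T i y" for i y
    by (auto simp: F_def best_replies_def)
  have T_coord: "T i y \<subseteq> coord_space blk i" if "i \<in> \<Lambda>" "y \<in> C" for i y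
    using T(3) D(4) that by blast
  have F_closed: "closed (Sigma C (F i))" if "i \<in> \<Lambda>" for i
    unfolding F_def using that T T_coord u(1)
    by (intro closed_graph_best_replies[where B = "coord_space blk i"]) auto
  have F_ne: "F i y \<noteq> {}" if iy: "i \<in> \<Lambda>" "y \<in> C" for i y
  proof -
    have "closed (T i y)"
      using closed_value_of_closed_graph[OF T(4)[OF iy(1)] iy(2)] .
    then have "compact (T i y)"
      using D(1)[OF iy(1)] T(3)[OF iy] by (metis compact_Int_closed inf.absorb2)
    moreover have "continuous_on (T i y) (\<lambda>v. u i (y, v))"
      using u(1)[OF iy(1)]
      by (auto intro!: continuous_on_compose2[of UNIV "u i"] continuous_intros)
    ultimately obtain w where "w \<in> T i y" "\<forall>v\<in>T i y. u i (y, v) \<le> u i (y, w)"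
      using continuous_attains_sup T(1)[OF iy] by meson
    then show ?thesis
      by (auto simp: F_def best_replies_def)
  qed
  have "\<exists>y\<in>C. y \<in> convex hull (\<Phi> y)"
  proof (rule fixed_point_in_convex_hull[OF C])
    fix y assume y: "y \<in> C"
    show "\<Phi> y \<noteq> {}"
      unfolding \<Phi>_def using F_ne F_sub T_coord y \<Lambda> by (intro block_prod_nonempty) blast+
    show "\<Phi> y \<subseteq> C"
      using F_sub T(3) y by (force simp: \<Phi>_def C_def block_prod_def)
  next
    have "continuous_on UNIV (\<lambda>p. (fst p, component blk i (snd p)))" for i
      by (intro continuous_on_Pair continuous_on_component continuous_intros)
    then have "closed ((\<lambda>p. (fst p, component blk i (snd p))) -` Sigma C (F i))"
      if "i \<in> \<Lambda>" for i
      using F_closed[OF that] closed_vimage by blast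
    moreover have "Sigma C \<Phi> = (C \<times> UNIV) \<inter>
        (\<Inter>i\<in>\<Lambda>. (\<lambda>p. (fst p, component blk i (snd p))) -` Sigma C (F i))"
      by (auto simp: \<Phi>_def block_prod_def)
    ultimately show "closed (Sigma C \<Phi>)"
      using compact_imp_closed[OF C(1)] by (auto intro!: closed_Int closed_Times closed_INT)
  qed
  then obtain y where y: "y \<in> C" "y \<in> convex hull (\<Phi> y)"
    by blast
  have "component blk i y \<in> T i y \<and> P i y \<inter> T i y = {}" if i: "i \<in> \<Lambda>" for i
  proof
    have hull: "component blk i y \<in> convex hull (F i y)"
      using convex_hull_block_prod_subset[OF i] y(2) unfolding \<Phi>_def by blast
    then show "component blk i y \<in> T i y"
      using hull_minimal[of "F i y" "T i y" convex] F_sub T(2)[OF i y(1)] by blast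
    show "P i y \<inter> T i y = {}"
    proof (rule ccontr)
      assume "P i y \<inter> T i y \<noteq> {}"
      then obtain v where v: "v \<in> P i y" "v \<in> T i y"
        by blast
      then have pos: "0 < u i (y, v)"
        using u(2)[OF i] T_coord[OF i y(1)] by blast
      have "F i y \<subseteq> P i y"
      proof
        fix w assume w: "w \<in> F i y"
        then have "0 < u i (y, w)"
          using pos v(2) by (force simp: F_def best_replies_def)
        then show "w \<in> P i y"
          using u(2)[OF i] T_coord[OF i y(1)] F_sub w by blast
      qed
      then show False
        using hull P(2)[OF i y(1)] hull_mono by blast
    qed
  qed
  then show ?thesis
    using y(1) by blast
qed

section \<open>Projected solutions\<close>

lemma norm_diff_closest_point:
  assumes "closed S" "S \<noteq> {}"
  shows "norm (y - closest_point S y) = (INF w\<in>S. norm (y - w))"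
proof (rule antisym)
  show "norm (y - closest_point S y) \<le> (INF w\<in>S. norm (y - w))"
    using assms closest_point_le[OF assms(1)] by (intro cINF_greatest) (auto simp: dist_norm)
  show "(INF w\<in>S. norm (y - w)) \<le> norm (y - closest_point S y)"
    using closest_point_in_set[OF assms] by (intro cINF_lower) (auto intro!: bdd_belowI[of _ 0])
qed

lemma lsc_multimap_compose:
  assumes "lsc_multimap A B F" "continuous_on C p" "p ` C \<subseteq> A"
  shows "lsc_multimap C B (\<lambda>y. F (p y))"
  unfolding lsc_multimap_def
proof (intro allI impI)
  fix V assume "openin (top_of_set B) V"
  then have "openin (top_of_set A) {x \<in> A. F x \<inter> V \<noteq> {}}"
    using assms(1) by (simp add: lsc_multimap_def)
  then have "openin (top_of_set C) (C \<inter> p -` {x \<in> A. F x \<inter> V \<noteq> {}})"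
    using assms(2,3) by (intro continuous_openin_preimage[where T = A]) auto
  moreover have "C \<inter> p -` {x \<in> A. F x \<inter> V \<noteq> {}} = {y \<in> C. F (p y) \<inter> V \<noteq> {}}"
    using assms(3) by auto
  ultimately show "openin (top_of_set C) {y \<in> C. F (p y) \<inter> V \<noteq> {}}"
    by simp
qed

theorem theorem4p2:
  fixes N :: nat
    and n :: "nat \<Rightarrow> nat"
    and blk :: "'n::finite \<Rightarrow> nat"
    and X :: "nat \<Rightarrow> (real ^ 'n) set"
    and K P :: "nat \<Rightarrow> real ^ 'n \<Rightarrow> (real ^ 'n) set"
  defines "\<Lambda> \<equiv> {1..N}"
  defines "XX \<equiv> block_prod blk \<Lambda> X"
  assumes dims: "\<forall>i\<in>\<Lambda>. n i \<ge> 1"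
    and blocks: "\<forall>k. blk k \<in> \<Lambda>" "\<forall>i\<in>\<Lambda>. card {k. blk k = i} = n i"
    and X_sub: "\<forall>i\<in>\<Lambda>. X i \<subseteq> coord_space blk i"
    and K_map: "\<forall>i\<in>\<Lambda>. multimap_on XX (coord_space blk i) (K i)"
    and P_map: "\<forall>i\<in>\<Lambda>. multimap_on UNIV (coord_space blk i) (P i)"
    and a: "\<forall>i\<in>\<Lambda>. X i \<noteq> {} \<and> closed (X i) \<and> convex (X i)"
    and b: "\<forall>i\<in>\<Lambda>. closed_multimap XX (coord_space blk i) (K i) \<and>
              lsc_multimap XX (coord_space blk i) (K i) \<and>
              (\<forall>x\<in>XX. K i x \<noteq> {} \<and> convex (K i x))"
    and c: "\<forall>i\<in>\<Lambda>. open_graph UNIV (coord_space blk i) (P i)"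
    and d: "\<forall>i\<in>\<Lambda>. \<forall>x\<in>block_prod blk \<Lambda> (\<lambda>j. convex hull (closure (\<Union>z\<in>XX. K j z))).
              component blk i x \<notin> convex hull (P i x)"
    and rel_compact: "\<forall>i\<in>\<Lambda>. compact (closure (\<Union>x\<in>XX. K i x))"
  shows "\<exists>x. projected_solution blk \<Lambda> X K P x"
proof -
  have fin: "finite \<Lambda>"
    by (simp add: \<Lambda>_def)
  have XX: "closed XX" "convex XX" "XX \<noteq> {}"
    unfolding XX_def using a X_sub fin blocks(1) block_prod_nonempty[of \<Lambda> blk X]
    by (auto intro!: closed_block_prod convex_block_prod)
  define p where "p = closest_point XX"
  have p_in: "p y \<in> XX" for y
    unfolding p_def using XX by (intro closest_point_in_set)
  have p_cont: "continuous_on S p" for S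
    unfolding p_def using XX by (intro continuous_on_closest_point)
  define D where "D i = convex hull (closure (\<Union>z\<in>XX. K i z))" for i
  define C where "C = block_prod blk \<Lambda> D"
  have K_D: "K i x \<subseteq> D i" if "x \<in> XX" for i x
    unfolding D_def using that by (meson UN_upper closure_subset hull_subset order_trans)
  have D: "compact (D i)" "convex (D i)" "D i \<noteq> {}" "D i \<subseteq> coord_space blk i" if i: "i \<in> \<Lambda>" for i
  proof -
    show "compact (D i)"
      unfolding D_def using rel_compact i by (simp add: compact_convex_hull)
    show "convex (D i)"
      by (simp add: D_def)
    obtain x where "x \<in> XX"
      using XX(3) by blast
    then show "D i \<noteq> {}"
      using b i K_D by blast
    have "(\<Union>z\<in>XX. K i z) \<subseteq> coord_space blk i"
      using K_map i by (auto simp: multimap_on_def)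
    then show "D i \<subseteq> coord_space blk i"
      unfolding D_def
      by (intro hull_minimal closure_minimal closed_subspace subspace_coord_space
          subspace_imp_convex)
  qed
  have "compact C"
    unfolding C_def using D(1) fin blocks(1) by (intro compact_block_prod) auto
  then have C: "closed C"
    by (rule compact_imp_closed)
  have graph: "closed (Sigma C (\<lambda>y. K i (p y)))" if i: "i \<in> \<Lambda>" for i
  proof -
    have "closed (Sigma XX (K i))"
      using b i XX(1) closedin_closed_trans closed_Times closed_subspace[OF subspace_coord_space]
      unfolding closed_multimap_def by blast
    then have "closed ((\<lambda>q. (p (fst q), snd q)) -` Sigma XX (K i))"
      by (intro closed_vimage continuous_intros continuous_on_compose2[OF p_cont[of UNIV]]) auto
    moreover have "Sigma C (\<lambda>y. K i (p y)) = (C \<times> UNIV) \<inter> (\<lambda>q. (p (fst q), snd q)) -` Sigma XX (K i)"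
      using p_in by auto
    ultimately show ?thesis
      using C by (auto intro!: closed_Int closed_Times)
  qed
  have "\<exists>y\<in>C. \<forall>i\<in>\<Lambda>. component blk i y \<in> K i (p y) \<and> P i y \<inter> K i (p y) = {}"
  proof (rule Shafer_Sonnenschein[OF fin blocks(1) D C_def])
    fix i assume i: "i \<in> \<Lambda>"
    show "lsc_multimap C (coord_space blk i) (\<lambda>y. K i (p y))"
      using b i p_in by (intro lsc_multimap_compose[OF _ p_cont]) auto
    show "closed (Sigma C (\<lambda>y. K i (p y)))"
      by (rule graph[OF i])
    show "open_graph UNIV (coord_space blk i) (P i)"
      using c i by blast
    fix y assume y: "y \<in> C"
    show "component blk i y \<notin> convex hull (P i y)"
      using d i y unfolding C_def D_def by blast
    show "K i (p y) \<noteq> {}" "convex (K i (p y))" "K i (p y) \<subseteq> D i"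
      using b i p_in K_D by auto
  qed
  then obtain y where y: "\<forall>i\<in>\<Lambda>. component blk i y \<in> K i (p y) \<and> P i y \<inter> K i (p y) = {}"
    by blast
  have "norm (y - p y) = (INF w\<in>block_prod blk \<Lambda> X. norm (y - w))"
    unfolding p_def XX_def using XX unfolding XX_def by (intro norm_diff_closest_point)
  then have "projected_solution blk \<Lambda> X K P (p y)"
    unfolding projected_solution_def using y p_in[of y] by (auto simp: XX_def)
  then show ?thesis
    by blast
qed

end
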